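(* For any nonempty zero-set $\mathcal{Z}$, with $s=s(\mathcal{Z})$, we have $\mu_{\mathrm{en}}(\mathcal{Z})\ge s^{1/2}$ and $\mu(\mathcal{Z})\ge\mu_{\mathrm{th}}(\mathcal{Z})\ge(s-1)^{1/2}$.
   Context: $\mathbb{Z}_+=\{0,1,2,\dots\}$, $\mathbb{N}=\{1,2,\dots\}$. For $a,b\in\mathbb{N}$, $R_{a,b}=([0,a-1]\times[0,b-1])\cap\mathbb{Z}_+^2$. A zero-set is a union $\mathcal{Z}=\bigcup_{(a,b)\in\mathcal{I}}R_{a,b}$ over a finite $\mathcal{I}\subseteq\mathbb{N}^2$. $s(\mathcal{Z})$ is the integer $s\ge0$ with $R_{s,s}\subseteq\mathcal{Z}$ but $R_{s+1,s+1}\not\subseteq\mathcal{Z}$. For $x\in\mathbb{Z}_+^2$, $L^h(x),L^v(x)$ are the horizontal and vertical lines through $x$; for $A\subseteq\mathbb{Z}_+^2$, $\mathtt{row}(x,A)=|L^h(x)\cap A|$, $\mathtt{col}(x,A)=|L^v(x)\cap A|$. Regular dynamics: $\mathcal{T}(A)=A\cup\{x\notin A:(\mathtt{row}(x,A),\mathtt{col}(x,A))\notin\mathcal{Z}\}$; $A$ spans if $\bigcup_t\mathcal{T}^t(A)=\mathbb{Z}_+^2$; for finite spanning $A$, $\tau(\mathcal{Z},A)=\min\{t\in\mathbb{N}:\mathcal{T}^t(A)=\mathbb{Z}_+^2\}$; $\mu(\mathcal{Z})=\sup$ of $\tau(\mathcal{Z},A)$ over finite spanning $A$. A finite set $A$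 is thin if for every $x\in A$, $\mathtt{row}(x,A)=1$ or $\mathtt{col}(x,A)=1$; $\mu_{\mathrm{th}}(\mathcal{Z})=\max\{\tau(\mathcal{Z},A):A\text{ thin and spanning}\}$. Enhanced dynamics: enhancements $\vec r=(r_0,r_1,\dots)$, $\vec c=(c_0,c_1,\dots)$ are weakly decreasing sequences of nonnegative integers; $\mathcal{T}_{\mathrm{en}}(A)=A\cup\{(i,j):(\mathtt{row}((i,j),A)+r_j,\mathtt{col}((i,j),A)+c_i)\notin\mathcal{Z}\}$; $(\vec r,\vec c)$ spans for $\mathcal{Z}$ if $\bigcup_t\mathcal{T}_{\mathrm{en}}^t(\emptyset)=\mathbb{Z}_+^2$; $\tau_{\mathrm{en}}(\mathcal{Z},\vec r,\vec c)=\inf\{t\in\mathbb{N}:\mathcal{T}_{\mathrm{en}}^t(\emptyset)=\mathbb{Z}_+^2\}$; $\mu_{\mathrm{en}}(\mathcal{Z})$ is the maximum of $\tau_{\mathrm{en}}$ over spanning pairs with finite support. *)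

theory Defs
  imports Complex_Main "HOL-Library.Extended_Nat" "HOL-Library.Extended_Real"
begin

type_synonym site = "nat \<times> nat"

definition rect :: "nat \<Rightarrow> nat \<Rightarrow> site set" where
  "rect a b = {0..<a} \<times> {0..<b}"

definition zero_set :: "site set \<Rightarrow> bool" where
  "zero_set Z \<longleftrightarrow>
     (\<exists>I. finite I \<and> I \<subseteq> {1..} \<times> {1..} \<and> Z = (\<Union>(a, b)\<in>I. rect a b))"

text \<open>For a zero-set this \<open>s\<close> exists and is unique, since the squares increase and the
  zero-set is finite.\<close>

definition square_size :: "site set \<Rightarrow> nat" where
  "square_size Z = (THE s. rect s s \<subseteq> Z \<and> \<not> rect (s + 1) (s + 1) \<subseteq> Z)"

definition hline :: "site \<Rightarrow> site set" where
  "hline x = {y. snd y = snd x}"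

definition vline :: "site \<Rightarrow> site set" where
  "vline x = {y. fst y = fst x}"

text \<open>Occupied sets become infinite under the dynamics, so occupation counts are
  extended naturals; \<^const>\<open>card\<close> alone would assign 0 to an infinite line.\<close>

definition ecard :: "'a set \<Rightarrow> enat" where
  "ecard A = (if finite A then enat (card A) else \<infinity>)"

definition row :: "site \<Rightarrow> site set \<Rightarrow> enat" where
  "row x A = ecard (hline x \<inter> A)"

definition col :: "site \<Rightarrow> site set \<Rightarrow> enat" where
  "col x A = ecard (vline x \<inter> A)"

text \<open>The zero-set viewed inside pairs of extended naturals; pairs with an infinite
  component lie outside it.\<close>

definition ext :: "site set \<Rightarrow> (enat \<times> enat) set" where
  "ext Z = map_prod enat enat ` Z"

definition step :: "site set \<Rightarrow> site set \<Rightarrow> site set" where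
  "step Z A = A \<union> {x. x \<notin> A \<and> (row x A, col x A) \<notin> ext Z}"

definition spans :: "site set \<Rightarrow> site set \<Rightarrow> bool" where
  "spans Z A \<longleftrightarrow> (\<Union>t. (step Z ^^ t) A) = UNIV"

definition tau :: "site set \<Rightarrow> site set \<Rightarrow> enat" where
  "tau Z A = (INF t\<in>{t. 1 \<le> t \<and> (step Z ^^ t) A = UNIV}. enat t)"

text \<open>Maxima of spanning times are rendered, like the supremum, by the supremum in
  \<^typ>\<open>enat\<close>: it equals the maximum whenever the maximum exists.\<close>

definition mu :: "site set \<Rightarrow> enat" where
  "mu Z = (SUP A\<in>{A. finite A \<and> spans Z A}. tau Z A)"

definition thin :: "site set \<Rightarrow> bool" where
  "thin A \<longleftrightarrow> finite A \<and> (\<forall>x\<in>A. row x A = 1 \<or> col x A = 1)"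

definition mu_th :: "site set \<Rightarrow> enat" where
  "mu_th Z = (SUP A\<in>{A. thin A \<and> spans Z A}. tau Z A)"

definition enhancement :: "(nat \<Rightarrow> nat) \<Rightarrow> bool" where
  "enhancement r \<longleftrightarrow> antimono r"

definition step_en ::
  "site set \<Rightarrow> (nat \<Rightarrow> nat) \<Rightarrow> (nat \<Rightarrow> nat) \<Rightarrow> site set \<Rightarrow> site set" where
  "step_en Z r c A =
     A \<union> {(i, j). (row (i, j) A + enat (r j), col (i, j) A + enat (c i)) \<notin> ext Z}"

definition spans_en :: "site set \<Rightarrow> (nat \<Rightarrow> nat) \<Rightarrow> (nat \<Rightarrow> nat) \<Rightarrow> bool" where
  "spans_en Z r c \<longleftrightarrow> (\<Union>t. (step_en Z r c ^^ t) {}) = UNIV"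

definition tau_en :: "site set \<Rightarrow> (nat \<Rightarrow> nat) \<Rightarrow> (nat \<Rightarrow> nat) \<Rightarrow> enat" where
  "tau_en Z r c = (INF t\<in>{t. 1 \<le> t \<and> (step_en Z r c ^^ t) {} = UNIV}. enat t)"

definition mu_en :: "site set \<Rightarrow> enat" where
  "mu_en Z =
     (SUP (r, c)\<in>{(r, c). enhancement r \<and> enhancement c \<and>
        finite {j. r j \<noteq> 0} \<and> finite {i. c i \<noteq> 0} \<and> spans_en Z r c}. tau_en Z r c)"

end

theory Submission
  imports Defs "HOL-Library.Nat_Bijection"
begin

text \<open>
  If the enhancements satisfy \<open>(x + r y, y + c x) \<notin> Z\<close> at every site, then a site becomes
  occupied as soon as everything to its left and below it is, so the dynamics spans.  If
  moreover there are levels \<open>k i\<close>, \<open>l i\<close> such that a quadrant surrounded by \<open>k i\<close> full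
  rows and \<open>l i\<close> full columns cannot grow inside its subquadrant with corner
  \<open>(l (i + 1), k (i + 1))\<close>, then \<open>m\<close> levels force time \<open>m + 1\<close>.

  Such a pair exists whenever \<open>m\<^sup>2 < s\<close>.  Shift the origin of \<open>Z\<close> to \<open>(L, K)\<close> and let
  \<open>(u, v)\<close> maximise \<open>u + v\<close>.  If \<open>u, v \<ge> m\<close>, enhancements decreasing with slope \<open>1\<close> from
  \<open>u\<close> and \<open>v + 1\<close> work.  Otherwise increase \<open>K\<close> by \<open>v + 1 \<le> m\<close> or \<open>L\<close> by \<open>u + 1 \<le> m\<close>,
  passing a corner of \<open>Z\<close>.  If this continues until \<open>K \<ge> s\<close> or \<open>L \<ge> s\<close>, then more than
  \<open>m\<close> corners have been passed in one direction, and enhancing each row by the length of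
  the next row of \<open>Z\<close> fills the rows with a delay at every corner.

  An enhancement \<open>r y\<close> is imitated by a thin set with \<open>r y\<close> far away points in row \<open>y\<close>,
  each alone in its column.
\<close>

section \<open>Zero-sets as finite down-sets, and their largest square\<close>

definition young :: "site set \<Rightarrow> bool" where
  "young Z \<longleftrightarrow> finite Z \<and>
     (\<forall>a b a' b'. (a, b) \<in> Z \<longrightarrow> a' \<le> a \<longrightarrow> b' \<le> b \<longrightarrow> (a', b') \<in> Z)"

lemma youngD: "young Z \<Longrightarrow> (a, b) \<in> Z \<Longrightarrow> a' \<le> a \<Longrightarrow> b' \<le> b \<Longrightarrow> (a', b') \<in> Z"
  unfolding young_def by blast

lemma young_converse: "young Z \<Longrightarrow> young (Z\<inverse>)"
  unfolding young_def by auto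

lemma zero_set_young:
  assumes "zero_set Z"
  shows "young Z"
proof -
  obtain I where I: "finite I" "Z = (\<Union>(a, b)\<in>I. rect a b)"
    using assms unfolding zero_set_def by blast
  then have "finite Z"
    by (auto simp: rect_def)
  moreover have mem: "(x, y) \<in> Z \<longleftrightarrow> (\<exists>a b. (a, b) \<in> I \<and> x < a \<and> y < b)" for x y
    unfolding I(2) rect_def by (simp add: Bex_def)
  ultimately show ?thesis
    unfolding young_def mem by (blast intro: le_less_trans)
qed

lemma young_bound:
  assumes "young Z"
  obtains P where "Z \<subseteq> {..<P} \<times> {..<P}"
proof -
  have "finite (fst ` Z \<union> snd ` Z)"
    using assms by (simp add: young_def)
  then obtain P where "\<forall>n \<in> fst ` Z \<union> snd ` Z. n < P"
    using finite_nat_set_iff_bounded by blast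
  then have "x < P \<and> y < P" if "(x, y) \<in> Z" for x y
    using that by (metis UnI1 UnI2 fst_conv image_eqI snd_conv)
  then have "Z \<subseteq> {..<P} \<times> {..<P}"
    by auto
  then show ?thesis by (rule that)
qed

text \<open>Boundedness of \<open>Z\<close> makes some square fail; the least failure gives
  \<open>s\<close>. Squares are nested, so no other value qualifies and the description in
  \<open>square_size\<close> is proper.\<close>

lemma square_size_rect:
  assumes "young Z"
  shows "rect (square_size Z) (square_size Z) \<subseteq> Z"
    and "\<not> rect (square_size Z + 1) (square_size Z + 1) \<subseteq> Z"
proof -
  obtain P where P: "Z \<subseteq> {..<P} \<times> {..<P}"
    using young_bound[OF assms] .
  then have "(P, P) \<notin> Z" by blast
  moreover have "(P, P) \<in> rect (P + 1) (P + 1)"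
    by (simp add: rect_def)
  ultimately have ex: "\<not> rect (P + 1) (P + 1) \<subseteq> Z"
    by blast
  define s where "s = (LEAST s. \<not> rect (s + 1) (s + 1) \<subseteq> Z)"
  have s2: "\<not> rect (s + 1) (s + 1) \<subseteq> Z"
    unfolding s_def using ex by (rule LeastI)
  have s1: "rect s s \<subseteq> Z"
  proof (cases s)
    case 0
    then show ?thesis by (simp add: rect_def)
  next
    case (Suc s')
    then have "rect (s' + 1) (s' + 1) \<subseteq> Z"
      using not_less_Least[of s' "\<lambda>s. \<not> rect (s + 1) (s + 1) \<subseteq> Z"] unfolding s_def[symmetric] by simp
    then show ?thesis by (simp add: Suc)
  qed
  have mono: "rect a a \<subseteq> rect b b" if "a \<le> b" for a b
    using that by (auto simp: rect_def)
  have uniq: "t = s" if "rect t t \<subseteq> Z" "\<not> rect (t + 1) (t + 1) \<subseteq> Z" for t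
  proof (rule ccontr)
    assume "t \<noteq> s"
    then have "t + 1 \<le> s \<or> s + 1 \<le> t" by linarith
    then show False
      using mono[of "t + 1" s] mono[of "s + 1" t] s1 s2 that by blast
  qed
  have "square_size Z = s"
    unfolding square_size_def using s1 s2 uniq by (intro the_equality) blast+
  then show "rect (square_size Z) (square_size Z) \<subseteq> Z"
    and "\<not> rect (square_size Z + 1) (square_size Z + 1) \<subseteq> Z"
    using s1 s2 by auto
qed

section \<open>Counting along lines\<close>

lemma ecard_mono: "A \<subseteq> B \<Longrightarrow> ecard A \<le> ecard B"
  by (auto simp: ecard_def card_mono dest: finite_subset)

lemma ecard_Un_le: "ecard (A \<union> B) \<le> ecard A + ecard B"
  by (auto simp: ecard_def card_Un_le)

lemma ecard_image: "inj_on f A \<Longrightarrow> ecard (f ` A) = ecard A"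
  by (auto simp: ecard_def card_image dest: finite_imageD)

lemma row_eq: "row (x, y) A = ecard {x'. (x', y) \<in> A}"
proof -
  have "hline (x, y) \<inter> A = (\<lambda>x'. (x', y)) ` {x'. (x', y) \<in> A}"
    by (auto simp: hline_def)
  then show ?thesis
    by (simp add: row_def ecard_image inj_on_def)
qed

lemma col_eq: "col (x, y) A = ecard {y'. (x, y') \<in> A}"
proof -
  have "vline (x, y) \<inter> A = (\<lambda>y'. (x, y')) ` {y'. (x, y') \<in> A}"
    by (auto simp: vline_def)
  then show ?thesis
    by (simp add: col_def ecard_image inj_on_def)
qed

lemma row_converse: "row (x, y) (A\<inverse>) = col (y, x) A"
  and col_converse: "col (x, y) (A\<inverse>) = row (y, x) A"
  by (simp_all add: row_eq col_eq)

lemma row_mono: "A \<subseteq> B \<Longrightarrow> row p A \<le> row p B"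
  and col_mono: "A \<subseteq> B \<Longrightarrow> col p A \<le> col p B"
  by (auto simp: row_def col_def intro!: ecard_mono)

lemma row_Un_le: "row p (A \<union> B) \<le> row p A + row p B"
  and col_Un_le: "col p (A \<union> B) \<le> col p A + col p B"
  by (auto simp: row_def col_def Int_Un_distrib ecard_Un_le)

lemma ecard_ge: "S \<subseteq> A \<Longrightarrow> finite S \<Longrightarrow> n \<le> card S \<Longrightarrow> enat n \<le> ecard A"
  using card_mono[of A S] by (auto simp: ecard_def)

lemma row_ge: "(\<And>x'. x' < n \<Longrightarrow> (x', y) \<in> A) \<Longrightarrow> enat n \<le> row (x, y) A"
  unfolding row_eq by (rule ecard_ge[of "{..<n}"]) auto

lemma col_ge: "(\<And>y'. y' < n \<Longrightarrow> (x, y') \<in> A) \<Longrightarrow> enat n \<le> col (x, y) A"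
  unfolding col_eq by (rule ecard_ge[of "{..<n}"]) auto

lemma not_in_ext:
  assumes "young Z" "(a, b) \<notin> Z" "enat a \<le> \<alpha>" "enat b \<le> \<beta>"
  shows "(\<alpha>, \<beta>) \<notin> ext Z"
proof
  assume "(\<alpha>, \<beta>) \<in> ext Z"
  then obtain a' b' where "(a', b') \<in> Z" "\<alpha> = enat a'" "\<beta> = enat b'"
    by (auto simp: ext_def)
  then show False
    using assms(2-4) youngD[OF assms(1), of a' b' a b] by simp
qed

lemma in_ext:
  assumes "young Z" "(a, b) \<in> Z" "\<alpha> \<le> enat a" "\<beta> \<le> enat b"
  shows "(\<alpha>, \<beta>) \<in> ext Z"
proof -
  obtain a' b' where "\<alpha> = enat a'" "\<beta> = enat b'"
    using assms(3,4) by (metis enat_ile)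
  moreover from this have "(a', b') \<in> Z"
    using assms(3,4) youngD[OF assms(1,2), of a' b'] by simp
  ultimately show ?thesis
    by (simp add: ext_def rev_image_eqI)
qed

section \<open>Spanning and slowness criteria\<close>

lemma step_eq_step_en: "step Z = step_en Z (\<lambda>_. 0) (\<lambda>_. 0)"
  by (auto simp: step_def step_en_def fun_eq_iff zero_enat_def[symmetric])

lemma iterates_mono: "t \<le> t' \<Longrightarrow> (step_en Z r c ^^ t) A \<subseteq> (step_en Z r c ^^ t') A"
  by (rule lift_Suc_mono_le[of "\<lambda>t. (step_en Z r c ^^ t) A"]) (auto simp: step_en_def)

text \<open>It suffices to choose \<open>n\<close> elements of the union, which may be infinite:
  being finitely many, they all lie in one stage of the chain.\<close>

lemma ecard_Union_chain:
  assumes "\<And>t. A t \<subseteq> A (Suc t)" "enat n \<le> ecard (\<Union>t. A t)"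
  obtains t where "enat n \<le> ecard (A t)"
proof -
  have "\<exists>S. S \<subseteq> (\<Union>t. A t) \<and> finite S \<and> card S = n"
  proof (cases "finite (\<Union>t. A t)")
    case True
    then have "n \<le> card (\<Union>t. A t)"
      using assms(2) by (simp add: ecard_def)
    then show ?thesis
      by (meson obtain_subset_with_card_n)
  next
    case False
    then show ?thesis
      by (metis infinite_arbitrarily_large)
  qed
  then obtain S where S: "S \<subseteq> (\<Union>t. A t)" "finite S" "card S = n"
    by blast
  have "\<exists>t. S \<subseteq> A t"
    using S(2,1)
  proof (induction S)
    case (insert a S)
    then obtain t t' where "S \<subseteq> A t" "a \<in> A t'" by auto
    then have "insert a S \<subseteq> A (max t t')"
      using lift_Suc_mono_le[of A t "max t t'", OF assms(1)]
        lift_Suc_mono_le[of A t' "max t t'", OF assms(1)] by auto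
    then show ?case by blast
  qed simp
  then show ?thesis
    using S that ecard_ge[of S _ n] by blast
qed

text \<open>Both thresholds are finite, hence reached at finite times, and one step after the later
  time the site is occupied. Spanning can thus be checked on the limit set alone.\<close>

lemma closure_closed:
  fixes Z A r c
  defines "S \<equiv> \<Union>t. (step_en Z r c ^^ t) A"
  assumes Z: "young Z" "(a, b) \<notin> Z"
    and a: "enat a \<le> row (x, y) S + enat (r y)" and b: "enat b \<le> col (x, y) S + enat (c x)"
  shows "(x, y) \<in> S"
proof -
  let ?A = "\<lambda>t. (step_en Z r c ^^ t) A"
  have A_Suc: "?A t \<subseteq> ?A (Suc t)" for t
    by (rule iterates_mono) simp
  \<comment> \<open>Truncated subtraction moves the enhancement to the threshold, also when it
    exceeds the threshold.\<close>
  have *: "enat (n - k) \<le> e" if "enat n \<le> e + enat k" for n k e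
    using that by (cases e) auto
  have "enat (a - r y) \<le> ecard (\<Union>t. {x'. (x', y) \<in> ?A t})"
    using *[OF a] by (simp add: row_eq S_def Collect_ex_eq)
  then obtain t1 where t1: "enat (a - r y) \<le> row (x, y) (?A t1)"
    unfolding row_eq by (erule ecard_Union_chain[rotated]) (intro Collect_mono impI, erule subsetD[OF A_Suc])
  have "enat (b - c x) \<le> ecard (\<Union>t. {y'. (x, y') \<in> ?A t})"
    using *[OF b] by (simp add: col_eq S_def Collect_ex_eq)
  then obtain t2 where t2: "enat (b - c x) \<le> col (x, y) (?A t2)"
    unfolding col_eq by (erule ecard_Union_chain[rotated]) (intro Collect_mono impI, erule subsetD[OF A_Suc])
  define t where "t = max t1 t2"
  have **: "enat n \<le> e + enat k" if "enat (n - k) \<le> e" for n k e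
    using that by (cases e) auto
  have "enat (a - r y) \<le> row (x, y) (?A t)" "enat (b - c x) \<le> col (x, y) (?A t)"
    using t1 t2 row_mono[OF iterates_mono[of t1 t]] col_mono[OF iterates_mono[of t2 t]]
    by (auto simp: t_def intro: order_trans)
  then have "(row (x, y) (?A t) + enat (r y), col (x, y) (?A t) + enat (c x)) \<notin> ext Z"
    by (intro not_in_ext[OF Z] **)
  then have "(x, y) \<in> ?A (Suc t)"
    by (simp add: step_en_def)
  then show ?thesis
    unfolding S_def by blast
qed

lemma grid_induct:
  assumes "\<And>x y. (\<And>x'. x' < x \<Longrightarrow> (x', y) \<in> S) \<Longrightarrow> (\<And>y'. y' < y \<Longrightarrow> (x, y') \<in> S)
    \<Longrightarrow> (x, y) \<in> S"
  shows "S = (UNIV :: site set)"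
proof -
  have "(x, y) \<in> S" for x y
  proof (induction "x + y" arbitrary: x y rule: less_induct)
    case less
    show ?case
      by (rule assms; rule less) simp_all
  qed
  then show ?thesis by auto
qed

text \<open>The \<open>max 1\<close> leaves room for the single point that a thin set may have in a far row or
  column, where the enhancement it imitates vanishes.\<close>

definition slow_pair :: "site set \<Rightarrow> nat \<Rightarrow> (nat \<Rightarrow> nat) \<Rightarrow> (nat \<Rightarrow> nat) \<Rightarrow> bool" where
  "slow_pair Z m r c \<longleftrightarrow>
     antimono r \<and> antimono c \<and> finite {j. r j \<noteq> 0} \<and> finite {i. c i \<noteq> 0} \<and>
     (\<forall>x y. (x + r y, y + c x) \<notin> Z) \<and>
     (\<exists>k l. \<forall>i<m. k i \<le> k (Suc i) \<and> l i \<le> l (Suc i) \<and>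
        (l i + max 1 (r (k (Suc i))), k i + max 1 (c (l (Suc i)))) \<in> Z)"

lemma slow_pair_converse: "slow_pair (Z\<inverse>) m r c \<Longrightarrow> slow_pair Z m c r"
  unfolding slow_pair_def by (simp, blast)

text \<open>The initial set and the enhancements together contribute at most
  \<open>max 1 (r y)\<close> and \<open>max 1 (c x)\<close>. This covers the enhanced dynamics from
  the empty set as well as the regular dynamics from a thin set.\<close>

lemma slow_iterates:
  assumes Z: "young Z" and slow: "slow_pair Z m r c" and "finite A" and "t \<le> m"
    and row: "\<And>x y. row (x, y) A + enat (r' y) \<le> enat (max 1 (r y))"
    and col: "\<And>x y. col (x, y) A + enat (c' x) \<le> enat (max 1 (c x))"
  shows "(step_en Z r' c' ^^ t) A \<noteq> UNIV"
proof -
  obtain k l where kl: "\<And>i. i < m \<Longrightarrow> k i \<le> k (Suc i)" "\<And>i. i < m \<Longrightarrow> l i \<le> l (Suc i)"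
    "\<And>i. i < m \<Longrightarrow> (l i + max 1 (r (k (Suc i))), k i + max 1 (c (l (Suc i)))) \<in> Z"
    and anti: "antimono r" "antimono c"
    using slow unfolding slow_pair_def by blast
  define B where "B i = {(x, y). x < l i \<or> y < k i}" for i
  have sub: "(step_en Z r' c' ^^ t) A \<subseteq> A \<union> B t" if "t \<le> m" for t
    using that
  proof (induction t)
    case (Suc t)
    let ?A = "(step_en Z r' c' ^^ t) A"
    have t: "t < m" and IH: "?A \<subseteq> A \<union> B t"
      using Suc by auto
    \<comment> \<open>Outside \<open>B (Suc t)\<close> the lines through a site meet
      \<open>B t\<close> in exactly \<open>l t\<close> and \<open>k t\<close> points, so by
      antimonotonicity both counts are bounded by the pair that lies in \<open>Z\<close>.\<close>
    have "(row (x, y) ?A + enat (r' y), col (x, y) ?A + enat (c' x)) \<in> ext Z"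
      if xy: "(x, y) \<notin> B (Suc t)" for x y
    proof (rule in_ext[OF Z kl(3)[OF t]])
      have le: "l (Suc t) \<le> x" "k (Suc t) \<le> y"
        using xy by (auto simp: B_def)
      then have "l t \<le> x" "k t \<le> y"
        using kl(1,2)[OF t] by auto
      then have "{x'. (x', y) \<in> B t} = {..<l t}" "{y'. (x, y') \<in> B t} = {..<k t}"
        by (auto simp: B_def)
      then have B: "row (x, y) (B t) = enat (l t)" "col (x, y) (B t) = enat (k t)"
        by (simp_all add: row_eq col_eq ecard_def)
      have "row (x, y) ?A \<le> row (x, y) A + enat (l t)"
        using order_trans[OF row_mono[OF IH] row_Un_le, of "(x, y)"] unfolding B .
      then have "row (x, y) ?A + enat (r' y) \<le> (row (x, y) A + enat (l t)) + enat (r' y)"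
        by (rule add_right_mono)
      also have "\<dots> = (row (x, y) A + enat (r' y)) + enat (l t)"
        by (simp only: ac_simps)
      also have "\<dots> \<le> enat (max 1 (r y)) + enat (l t)"
        using row by (rule add_right_mono)
      also have "\<dots> \<le> enat (l t + max 1 (r (k (Suc t))))"
        using antimonoD[OF anti(1) le(2)] by auto
      finally show "row (x, y) ?A + enat (r' y) \<le> enat (l t + max 1 (r (k (Suc t))))" .
      have "col (x, y) ?A \<le> col (x, y) A + enat (k t)"
        using order_trans[OF col_mono[OF IH] col_Un_le, of "(x, y)"] unfolding B .
      then have "col (x, y) ?A + enat (c' x) \<le> (col (x, y) A + enat (k t)) + enat (c' x)"
        by (rule add_right_mono)
      also have "\<dots> = (col (x, y) A + enat (c' x)) + enat (k t)"
        by (simp only: ac_simps)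
      also have "\<dots> \<le> enat (max 1 (c x)) + enat (k t)"
        using col by (rule add_right_mono)
      also have "\<dots> \<le> enat (k t + max 1 (c (l (Suc t))))"
        using antimonoD[OF anti(2) le(1)] by auto
      finally show "col (x, y) ?A + enat (c' x) \<le> enat (k t + max 1 (c (l (Suc t))))" .
    qed
    moreover have "B t \<subseteq> B (Suc t)"
      using kl(1,2)[OF t] by (auto simp: B_def)
    ultimately show ?case
      using IH unfolding funpow.simps(2) o_apply step_en_def[of Z r' c' ?A] by blast
  qed simp
  show ?thesis
  proof
    assume "(step_en Z r' c' ^^ t) A = UNIV"
    \<comment> \<open>The quadrant left over by \<open>B t\<close> is infinite, so the finite set
      \<open>A\<close> cannot cover it.\<close>
    then have "- B t \<subseteq> A"
      using sub[OF \<open>t \<le> m\<close>] by auto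
    moreover have "range (\<lambda>x. (l t + x, k t)) \<subseteq> - B t"
      by (auto simp: B_def)
    ultimately have "finite (range (\<lambda>x. (l t + x, k t)))"
      using \<open>finite A\<close> by (blast intro: finite_subset)
    then have "finite (UNIV :: nat set)"
      by (rule finite_imageD) (simp add: inj_on_def)
    then show False
      by simp
  qed
qed

lemma slow_pair_mu_en:
  assumes Z: "young Z" and slow: "slow_pair Z m r c"
  shows "enat (Suc m) \<le> mu_en Z"
proof -
  have anti: "antimono r" "antimono c" "finite {j. r j \<noteq> 0}" "finite {i. c i \<noteq> 0}"
    and out: "\<And>x y. (x + r y, y + c x) \<notin> Z"
    using slow unfolding slow_pair_def by blast+
  define S where "S = (\<Union>t. (step_en Z r c ^^ t) {})"
  have "S = UNIV"
  proof (rule grid_induct)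
    fix x y
    assume "\<And>x'. x' < x \<Longrightarrow> (x', y) \<in> S" "\<And>y'. y' < y \<Longrightarrow> (x, y') \<in> S"
    then have "enat x \<le> row (x, y) S" "enat y \<le> col (x, y) S"
      by (simp_all add: row_ge col_ge)
    then show "(x, y) \<in> S"
      unfolding S_def using closure_closed[OF Z out[of x y]] add_right_mono
      by (metis plus_enat_simps(1))
  qed
  then have spans: "spans_en Z r c"
    by (simp add: spans_en_def S_def)
  have "m < t" if "(step_en Z r c ^^ t) {} = UNIV" for t
  proof (rule ccontr)
    assume "\<not> m < t"
    then show False
      using slow_iterates[OF Z slow, of "{}" t r c] that
      by (simp add: row_eq col_eq ecard_def zero_enat_def[symmetric])
  qed
  then have "enat (Suc m) \<le> tau_en Z r c"
    unfolding tau_en_def by (intro INF_greatest) (auto simp: Suc_le_eq)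
  also have "\<dots> \<le> mu_en Z"
    unfolding mu_en_def using anti spans
    by (intro SUP_upper2[of "(r, c)"]) (auto simp: enhancement_def)
  finally show ?thesis .
qed

section \<open>Thin sets imitating enhancements\<close>

text \<open>Injectivity of \<open>prod_encode\<close> gives every point a column of its own;
  \<open>N\<close> pushes these columns out of the way.\<close>

definition spread :: "nat \<Rightarrow> (nat \<Rightarrow> nat) \<Rightarrow> site set" where
  "spread N r = {(N + prod_encode (t, y), y) | t y. t < r y}"

lemma row_spread: "row (x, y) (spread N r) = enat (r y)"
proof -
  have "{x'. (x', y) \<in> spread N r} = (\<lambda>t. N + prod_encode (t, y)) ` {..<r y}"
    unfolding spread_def by blast
  moreover have "inj_on (\<lambda>t. N + prod_encode (t, y)) {..<r y}"
    by (simp add: inj_on_def)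
  ultimately have "row (x, y) (spread N r) = ecard {..<r y}"
    by (simp only: row_eq ecard_image)
  then show ?thesis
    by (simp add: ecard_def)
qed

lemma spread_column:
  "(x, y) \<in> spread N r \<Longrightarrow> (x, y') \<in> spread N r \<Longrightarrow> y' = y"
  by (auto simp: spread_def)

lemma spread_far: "(x, y) \<in> spread N r \<Longrightarrow> N \<le> x \<and> r y \<noteq> 0"
  by (auto simp: spread_def)

lemma col_spread_le: "col (x, y) (spread N r) \<le> 1"
proof -
  have "{y'. (x, y') \<in> spread N r} = {} \<or> (\<exists>y0. {y'. (x, y') \<in> spread N r} = {y0})"
    using spread_column by blast
  then show ?thesis
    by (auto simp: col_eq ecard_def one_enat_def)
qed

lemma finite_spread:
  assumes "antimono r" "finite {j. r j \<noteq> 0}"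
  shows "finite (spread N r)"
proof -
  have "spread N r \<subseteq> (\<lambda>(t, y). (N + prod_encode (t, y), y)) ` ({..<r 0} \<times> {j. r j \<noteq> 0})"
  proof
    fix p
    assume "p \<in> spread N r"
    then obtain t y where p: "p = (N + prod_encode (t, y), y)" "t < r y"
      unfolding spread_def by blast
    then have "t < r 0" "r y \<noteq> 0"
      using antimonoD[OF assms(1), of 0 y] by auto
    then show "p \<in> (\<lambda>(t, y). (N + prod_encode (t, y), y)) ` ({..<r 0} \<times> {j. r j \<noteq> 0})"
      using p(1) by (intro image_eqI[of _ _ "(t, y)"]) auto
  qed
  then show ?thesis
    using assms(2) by (meson finite_SigmaI finite_imageI finite_lessThan finite_subset)
qed

text \<open>Below \<open>N\<close> in both coordinates, the far points supply the enhancements. A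
  site with a coordinate at least \<open>N\<close> is occupied once everything to its left and below
  it is, since one of its counts already exceeds \<open>Z\<close>.\<close>

lemma slow_pair_mu_th:
  assumes Z: "young Z" and slow: "slow_pair Z m r c"
  shows "enat (Suc m) \<le> mu_th Z"
proof -
  have anti: "antimono r" "antimono c" and fin: "finite {j. r j \<noteq> 0}" "finite {i. c i \<noteq> 0}"
    and out: "\<And>x y. (x + r y, y + c x) \<notin> Z"
    using slow unfolding slow_pair_def by blast+
  obtain P where P: "Z \<subseteq> {..<P} \<times> {..<P}"
    using young_bound[OF Z] .
  obtain N where N: "\<forall>n \<in> {..<P} \<union> {j. r j \<noteq> 0} \<union> {i. c i \<noteq> 0}. n < N"
    using fin finite_nat_set_iff_bounded[of "{..<P} \<union> {j. r j \<noteq> 0} \<union> {i. c i \<noteq> 0}"] by auto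
  have "n < N" if "n < P \<or> r n \<noteq> 0 \<or> c n \<noteq> 0" for n
    using N that by blast
  then have small: "\<not> N \<le> n" if "n < P \<or> r n \<noteq> 0 \<or> c n \<noteq> 0" for n
    using that by (meson not_le)
  have far: "r n = 0" "c n = 0" "(n, a) \<notin> Z" "(a, n) \<notin> Z" if "N \<le> n" for n a
    using small[of n] that P by blast+
  define A where "A = spread N r \<union> (spread N c)\<inverse>"
  have finA: "finite A"
    using finite_spread anti fin by (simp add: A_def)
  have row0: "row (x, y) ((spread N c)\<inverse>) = 0" if "y < N" for x y
  proof -
    have "{x'. (x', y) \<in> (spread N c)\<inverse>} = {}"
      using that spread_far[of y _ N c] not_le by blast
    then show ?thesis
      by (simp add: row_eq ecard_def zero_enat_def)
  qed
  have col0: "col (x, y) (spread N r) = 0" if "x < N" for x y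
  proof -
    have "{y'. (x, y') \<in> spread N r} = {}"
      using that spread_far[of x _ N r] not_le by blast
    then show ?thesis
      by (simp add: col_eq ecard_def zero_enat_def)
  qed
  have rowA: "row (x, y) A \<le> enat (max 1 (r y))" for x y
  proof -
    have "row (x, y) A \<le> enat (r y) + row (x, y) ((spread N c)\<inverse>)"
      unfolding A_def row_spread[symmetric, of r y x N] by (rule row_Un_le)
    also have "\<dots> \<le> enat (max 1 (r y))"
    proof (cases "y < N")
      case False
      then have "r y = 0" by (simp add: far)
      then show ?thesis
        using col_spread_le[of y x N c] by (simp add: row_converse one_enat_def zero_enat_def[symmetric])
    qed (simp add: row0)
    finally show ?thesis .
  qed
  have colA: "col (x, y) A \<le> enat (max 1 (c x))" for x y
  proof -
    have "col (x, y) A \<le> col (x, y) (spread N r) + enat (c x)"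
      using col_Un_le[of "(x, y)" "spread N r" "(spread N c)\<inverse>"]
      by (simp add: A_def col_converse row_spread)
    also have "\<dots> \<le> enat (max 1 (c x))"
    proof (cases "x < N")
      case False
      then have "c x = 0" by (simp add: far)
      then show ?thesis
        using col_spread_le[of x y N r] by (simp add: one_enat_def zero_enat_def[symmetric])
    qed (simp add: col0)
    finally show ?thesis .
  qed
  have thin: "thin A"
    unfolding thin_def
  proof (intro conjI ballI finA)
    fix p
    assume p: "p \<in> A"
    obtain x y where xy: "p = (x, y)" by fastforce
    from p consider "(x, y) \<in> spread N r" | "(y, x) \<in> spread N c"
      by (auto simp: A_def xy)
    then show "row p A = 1 \<or> col p A = 1"
    proof cases
      \<comment> \<open>The point lies in a column beyond \<open>N\<close>, where \<open>c\<close>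
        vanishes, so \<open>colA\<close> allows only one point there. The other case is its
        reflection.\<close>
      case 1
      then have "c x = 0"
        using spread_far far by blast
      moreover have "enat 1 \<le> col (x, y) A"
        unfolding col_eq by (rule ecard_ge[of "{y}"]) (use p xy in auto)
      ultimately show ?thesis
        using colA[of x y] by (simp add: xy one_enat_def)
    next
      case 2
      then have "r y = 0"
        using spread_far far by blast
      moreover have "enat 1 \<le> row (x, y) A"
        unfolding row_eq by (rule ecard_ge[of "{x}"]) (use p xy in auto)
      ultimately show ?thesis
        using rowA[of x y] by (simp add: xy one_enat_def)
    qed
  qed
  define S where "S = (\<Union>t. (step_en Z (\<lambda>_. 0) (\<lambda>_. 0) ^^ t) A)"
  have AS: "A \<subseteq> S"
    unfolding S_def by (metis UNIV_I UN_upper funpow_0)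
  have closed: "(x, y) \<in> S"
    if "(a, b) \<notin> Z" "enat a \<le> row (x, y) S" "enat b \<le> col (x, y) S" for a b x y
    unfolding S_def using closure_closed[OF Z that(1)] that(2,3)
    by (simp add: S_def zero_enat_def[symmetric])
  \<comment> \<open>The bound \<open>n <= N\<close> keeps the initial segment disjoint from the far
    points, so that the two counts add up.\<close>
  have row_far: "enat (n + r y) \<le> row (x, y) S"
    if "n \<le> N" "\<And>x'. x' < n \<Longrightarrow> (x', y) \<in> S" for n x y
  proof -
    let ?F = "(\<lambda>t. N + prod_encode (t, y)) ` {..<r y}"
    have "card ({..<n} \<union> ?F) = card {..<n} + card ?F"
      using that(1) by (intro card_Un_disjoint) auto
    then have "n + r y \<le> card ({..<n} \<union> ?F)"
      by (simp add: card_image inj_on_def)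
    moreover have "{..<n} \<union> ?F \<subseteq> {x'. (x', y) \<in> S}"
      using that(2) AS by (auto simp: A_def spread_def)
    ultimately show ?thesis
      unfolding row_eq by (intro ecard_ge[of "{..<n} \<union> ?F"]) auto
  qed
  have col_far: "enat (n + c x) \<le> col (x, y) S"
    if "n \<le> N" "\<And>y'. y' < n \<Longrightarrow> (x, y') \<in> S" for n x y
  proof -
    let ?F = "(\<lambda>t. N + prod_encode (t, x)) ` {..<c x}"
    have "card ({..<n} \<union> ?F) = card {..<n} + card ?F"
      using that(1) by (intro card_Un_disjoint) auto
    then have "n + c x \<le> card ({..<n} \<union> ?F)"
      by (simp add: card_image inj_on_def)
    moreover have "{..<n} \<union> ?F \<subseteq> {y'. (x, y') \<in> S}"
      using that(2) AS by (auto simp: A_def spread_def)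
    ultimately show ?thesis
      unfolding col_eq by (intro ecard_ge[of "{..<n} \<union> ?F"]) auto
  qed
  have "S = UNIV"
  proof (rule grid_induct)
    fix x y
    assume left: "\<And>x'. x' < x \<Longrightarrow> (x', y) \<in> S" and below: "\<And>y'. y' < y \<Longrightarrow> (x, y') \<in> S"
    consider "N \<le> x" | "N \<le> y" | "x < N" "y < N" by linarith
    then show "(x, y) \<in> S"
    proof cases
      case 1
      show ?thesis
        by (rule closed[OF far(3)[OF 1, of 0] row_ge]) (use left in \<open>auto simp: zero_enat_def[symmetric]\<close>)
    next
      case 2
      show ?thesis
        by (rule closed[OF far(4)[OF 2, of 0] _ col_ge]) (use below in \<open>auto simp: zero_enat_def[symmetric]\<close>)
    next
      case 3
      show ?thesis
      proof (rule closed[OF out[of x y]])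
        show "enat (x + r y) \<le> row (x, y) S"
          by (rule row_far) (use 3 left in auto)
        show "enat (y + c x) \<le> col (x, y) S"
          by (rule col_far) (use 3 below in auto)
      qed
    qed
  qed
  then have spans: "spans Z A"
    by (simp add: spans_def S_def step_eq_step_en)
  have "m < t" if "(step Z ^^ t) A = UNIV" for t
  proof (rule ccontr)
    assume "\<not> m < t"
    then show False
      using slow_iterates[OF Z slow finA, of t "\<lambda>_. 0" "\<lambda>_. 0"] that rowA colA
      by (simp add: step_eq_step_en zero_enat_def[symmetric])
  qed
  then have "enat (Suc m) \<le> tau Z A"
    unfolding tau_def by (intro INF_greatest) (auto simp: Suc_le_eq)
  also have "\<dots> \<le> mu_th Z"
    unfolding mu_th_def using thin spans by (intro SUP_upper) auto
  finally show ?thesis .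
qed

section \<open>Existence of slow pairs\<close>

text \<open>Relative to the origin \<open>(L, K)\<close>, the two slope-one enhancements raise the
  coordinate sum of every site to at least \<open>u + v + 1\<close>, beyond the maximum over
  \<open>Z\<close>. Along the diagonal levels the pair still stays below
  \<open>(L + u, K + v)\<close>.\<close>

lemma slow_pair_corner:
  assumes Z: "young Z" and uv: "(L + u, K + v) \<in> Z" and m: "m \<le> u" "m \<le> v"
    and max: "\<And>u' v'. (L + u', K + v') \<in> Z \<Longrightarrow> u' + v' \<le> u + v"
  shows "\<exists>r c. slow_pair Z m r c"
proof -
  obtain P where P: "Z \<subseteq> {..<P} \<times> {..<P}"
    using young_bound[OF Z] .
  have uvP: "u < P" "v < P"
    using P uv by auto
  \<comment> \<open>The value \<open>P\<close> takes the rows below \<open>K\<close> out of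
    \<open>Z\<close> at once, and likewise the columns left of \<open>L\<close>. The extra 1 in
    \<open>Suc v\<close> is what passes the maximal sum.\<close>
  define r where "r y = (if y < K then P else u - (y - K))" for y
  define c where "c x = (if x < L then P else Suc v - (x - L))" for x
  have "antimono r" "antimono c"
    using uvP by (auto simp: r_def c_def antimono_def)
  moreover have "{j. r j \<noteq> 0} \<subseteq> {..K + u}" "{i. c i \<noteq> 0} \<subseteq> {..L + Suc v}"
    by (auto simp: r_def c_def)
  then have "finite {j. r j \<noteq> 0}" "finite {i. c i \<noteq> 0}"
    by (meson finite_atMost finite_subset)+
  moreover have "(x + r y, y + c x) \<notin> Z" for x y
  proof (cases "x < L \<or> y < K")
    case True
    then show ?thesis
      using P by (auto simp: r_def c_def)
  next
    case False
    then obtain x' y' where xy: "x = L + x'" "y = K + y'"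
      by (metis le_Suc_ex linorder_not_le)
    show ?thesis
      using max[of "x' + (u - y')" "y' + (Suc v - x')"] by (auto simp: xy r_def c_def algebra_simps)
  qed
  \<comment> \<open>Here \<open>r\<close> equals \<open>u - Suc i\<close>, and \<open>c\<close>
    equals \<open>v - i\<close>, which is positive. The second coordinate is thus
    \<open>K + v\<close>, and the first is at most \<open>L + u\<close> even when
    \<open>max 1\<close> takes effect.\<close>
  moreover have "(L + i + max 1 (r (K + Suc i)), K + i + max 1 (c (L + Suc i))) \<in> Z" if "i < m" for i
    by (rule youngD[OF Z uv]) (use that m in \<open>auto simp: r_def c_def\<close>)
  then have "\<exists>k l. \<forall>i<m. k i \<le> k (Suc i) \<and> l i \<le> l (Suc i) \<and>
        (l i + max 1 (r (k (Suc i))), k i + max 1 (c (l (Suc i)))) \<in> Z"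
    by (intro exI[of _ "\<lambda>i. K + i"] exI[of _ "\<lambda>i. L + i"]) auto
  ultimately show ?thesis
    unfolding slow_pair_def by blast
qed

text \<open>The bound \<open>u \<ge> 1\<close> keeps the shorter rows nonempty up to the last descent, as required by
  the \<open>max 1\<close> in \<^const>\<open>slow_pair\<close>.\<close>

definition descents :: "site set \<Rightarrow> nat set" where
  "descents Z = {j. \<exists>u\<ge>1. (u, j) \<in> Z \<and> (u, Suc j) \<notin> Z}"

text \<open>Once the rows below \<open>k i\<close> are full, rows from the next descent on still
  cannot grow: there \<open>r\<close> is the length of a strictly shorter row of \<open>Z\<close>.
  No full columns are involved, so the column levels are all 0.\<close>

lemma slow_pair_descents:
  assumes Z: "young Z" and T: "T \<subseteq> descents Z" "finite T" "m < card T"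
  shows "\<exists>r c. slow_pair Z m r c"
proof -
  obtain P where P: "Z \<subseteq> {..<P} \<times> {..<P}"
    using young_bound[OF Z] .
  \<comment> \<open>\<open>f v\<close> is the length of row \<open>v\<close> of
    \<open>Z\<close>.\<close>
  define f where "f v = (LEAST u. (u, v) \<notin> Z)" for v
  have "(P, v) \<notin> Z" for v
    using P by auto
  then have f_out: "(f v, v) \<notin> Z" for v
    unfolding f_def by (rule LeastI)
  have f_le: "f v \<le> u" if "(u, v) \<notin> Z" for u v
    unfolding f_def using that by (rule Least_le)
  define r where "r y = f (Suc y)" for y
  \<comment> \<open>\<open>c = 1\<close> compensates the shift by one row in \<open>r\<close>; without the shift the extra point of
    a thin set in a far column would undo the delay.\<close>
  define c where "c x = (if x < P then 1 else 0 :: nat)" for x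
  \<comment> \<open>The descents in increasing order; \<open>m\<close> delays need the
    \<open>m + 1\<close> levels \<open>k 0\<close> to \<open>k m\<close>, whence
    \<open>m < card T\<close>.\<close>
  define k where "k i = sorted_list_of_set T ! i" for i
  have k_less: "k i < k (Suc i)" if "i < m" for i
    using that T(3) strict_sorted_list_of_set[of T]
    unfolding k_def sorted_wrt_iff_nth_less by auto
  have k_in: "k i \<in> descents Z" if "i \<le> m" for i
  proof -
    have "k i \<in> set (sorted_list_of_set T)"
      unfolding k_def by (rule nth_mem) (use that T(3) in simp)
    then show ?thesis
      using T(1,2) by auto
  qed
  have "f w \<le> f v" if "v \<le> w" for v w
    using f_le[of "f v" w] f_out[of v] youngD[OF Z, of "f v" w "f v" v] that by blast
  then have "antimono r" "antimono c"
    by (simp_all add: r_def c_def antimono_def)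
  moreover have "{j. r j \<noteq> 0} \<subseteq> {..P}" "{i. c i \<noteq> 0} \<subseteq> {..P}"
  proof -
    have "j \<le> P" if "r j \<noteq> 0" for j
      using f_le[of 0 "Suc j"] subsetD[OF P, of "(0, Suc j)"] that
      by (cases "(0, Suc j) \<in> Z") (auto simp: r_def)
    then show "{j. r j \<noteq> 0} \<subseteq> {..P}"
      by blast
  qed (auto simp: c_def)
  then have "finite {j. r j \<noteq> 0}" "finite {i. c i \<noteq> 0}"
    by (meson finite_atMost finite_subset)+
  moreover have "(x + r y, y + c x) \<notin> Z" for x y
  proof (cases "x < P")
    case True
    then show ?thesis
      using youngD[OF Z, of "x + r y" "Suc y" "r y" "Suc y"] f_out[of "Suc y"] by (auto simp: c_def r_def)
  next
    case False
    then show ?thesis using P by auto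
  qed
  moreover have "(0 + max 1 (r (k (Suc i))), k i + max 1 (c 0)) \<in> Z" if i: "i < m" for i
  proof -
    obtain u where u: "1 \<le> u" "(u, k (Suc i)) \<in> Z" "(u, Suc (k (Suc i))) \<notin> Z"
      using k_in[of "Suc i"] i by (auto simp: descents_def)
    show ?thesis
      by (rule youngD[OF Z u(2)]) (use u f_le[OF u(3)] k_less[OF i] in \<open>auto simp: r_def c_def\<close>)
  qed
  then have "\<exists>k l. \<forall>i<m. k i \<le> k (Suc i) \<and> l i \<le> l (Suc i) \<and>
        (l i + max 1 (r (k (Suc i))), k i + max 1 (c (l (Suc i)))) \<in> Z"
    using k_less by (intro exI[of _ k] exI[of _ "\<lambda>_. 0"]) (auto intro: less_imp_le)
  ultimately show ?thesis
    unfolding slow_pair_def by blast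
qed

text \<open>If no slow pair exists, each direction has at most \<open>m\<close> descents, and the
  moving origin pays for every advance of at most \<open>m\<close> with a new descent. Its
  coordinates then never exceed \<open>m * m < s\<close>, yet it must leave the square.\<close>

lemma slow_pair_exists:
  assumes Z: "young Z" and rect: "rect s s \<subseteq> Z" and m: "m * m < s"
  shows "\<exists>r c. slow_pair Z m r c"
proof (rule ccontr)
  assume no: "\<nexists>r c. slow_pair Z m r c"
  have ms: "m < s"
    using m by (metis le_square linorder_not_le order_less_le_trans order_less_imp_le)
  have sq: "(a, b) \<in> Z" if "a < s" "b < s" for a b
    using rect that by (auto simp: rect_def)
  define d where "d Y n = card (descents Y \<inter> {..<n})" for Y n
  have d_small: "d Z n \<le> m" "d (Z\<inverse>) n \<le> m" for n
    using no slow_pair_descents[OF Z, of "descents Z \<inter> {..<n}" m]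
      slow_pair_descents[OF young_converse[OF Z], of "descents (Z\<inverse>) \<inter> {..<n}" m]
      slow_pair_converse[of Z m]
    unfolding d_def by (meson finite_Int finite_lessThan inf_le1 not_le)+
  have d_Suc: "Suc (d Y n) \<le> d Y (Suc (n + j))" if "n + j \<in> descents Y" for Y n j
  proof -
    have "insert (n + j) (descents Y \<inter> {..<n}) \<subseteq> descents Y \<inter> {..<Suc (n + j)}"
      using that by auto
    then have "card (insert (n + j) (descents Y \<inter> {..<n})) \<le> d Y (Suc (n + j))"
      unfolding d_def by (intro card_mono) auto
    then show ?thesis
      by (simp add: d_def)
  qed
  \<comment> \<open>Each coordinate is at most \<open>m\<close> times the number of descents already
    passed in its direction.\<close>
  define inv where "inv K L \<longleftrightarrow> K \<le> m * d Z K \<and> L \<le> m * d (Z\<inverse>) L" for K L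
  have step: "\<exists>K' L'. inv K' L' \<and> K + L < K' + L'" if "K < s" "L < s" "inv K L" for K L
  proof -
    define Q where "Q = {(u, v). (L + u, K + v) \<in> Z}"
    have "finite ((\<lambda>(u, v). (L + u, K + v)) -` Z)"
      using Z by (intro finite_vimageI) (auto simp: young_def inj_on_def)
    then have "finite Q"
      by (simp add: Q_def vimage_def case_prod_unfold)
    moreover have "Q \<noteq> {}"
      using sq[OF that(2,1)] unfolding Q_def by (auto intro!: exI[of _ "0::nat"])
    ultimately have "\<exists>p \<in> Q. \<forall>q \<in> Q. fst q + snd q \<le> fst p + snd p"
      using Max_in[of "(\<lambda>p. fst p + snd p) ` Q"] Max_ge[of "(\<lambda>p. fst p + snd p) ` Q"]
      by (metis (no_types, lifting) finite_imageI imageE imageI image_is_empty)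
    then obtain u v where uv: "(L + u, K + v) \<in> Z"
      and max: "\<And>u' v'. (L + u', K + v') \<in> Z \<Longrightarrow> u' + v' \<le> u + v"
      by (auto simp: Q_def)
    have "u < m \<or> v < m"
    proof (rule ccontr)
      assume "\<not> (u < m \<or> v < m)"
      then have "m \<le> u" "m \<le> v" by auto
      then show False
        using slow_pair_corner[OF Z uv _ _ max] no by blast
    qed
    then show ?thesis
    proof
      assume v: "v < m"
      \<comment> \<open>Descents must sit at positive row length. If \<open>L + u = 0\<close>, the
        maximal sum is \<open>v < m\<close>, but the bottom edge of the square contributes
        \<open>s - 1\<close>.\<close>
      have "1 \<le> L + u"
      proof (rule ccontr)
        assume "\<not> 1 \<le> L + u"
        then have "L = 0" "u = 0" by auto
        then have "s - 1 \<le> v"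
          using max[of "s - 1" 0] sq[of "s - 1" K] that by auto
        then show False using v ms by linarith
      qed
      moreover have "(L + u, Suc (K + v)) \<notin> Z"
        using max[of u "Suc v"] by auto
      ultimately have "K + v \<in> descents Z"
        using uv by (auto simp: descents_def)
      then have "m * Suc (d Z K) \<le> m * d Z (Suc (K + v))"
        by (intro mult_le_mono2 d_Suc)
      then have "inv (Suc (K + v)) L"
        using that(3) v by (auto simp: inv_def)
      then show ?thesis by fastforce
    next
      assume u: "u < m"
      have "1 \<le> K + v"
      proof (rule ccontr)
        assume "\<not> 1 \<le> K + v"
        then have "K = 0" "v = 0" by auto
        then have "s - 1 \<le> u"
          using max[of 0 "s - 1"] sq[of L "s - 1"] that by auto
        then show False using u ms by linarith
      qed
      moreover have "(Suc (L + u), K + v) \<notin> Z"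
        using max[of "Suc u" v] by auto
      ultimately have "L + u \<in> descents (Z\<inverse>)"
        using uv by (auto simp: descents_def)
      then have "m * Suc (d (Z\<inverse>) L) \<le> m * d (Z\<inverse>) (Suc (L + u))"
        by (intro mult_le_mono2 d_Suc)
      then have "inv K (Suc (L + u))"
        using that(3) u by (auto simp: inv_def)
      then show ?thesis by fastforce
    qed
  qed
  \<comment> \<open>The sum \<open>K + L\<close> grows with every move, so taking
    \<open>n = s + s\<close> forces a coordinate to reach \<open>s\<close>.\<close>
  have "\<exists>K L. inv K L \<and> (s \<le> K \<or> s \<le> L \<or> n \<le> K + L)" for n
  proof (induction n)
    case 0
    have "inv 0 0" by (simp add: inv_def)
    then show ?case by auto
  next
    case (Suc n)
    then show ?case
      using step by (metis Suc_leI le_less_trans not_le)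
  qed
  from this[of "s + s"] obtain K L where "inv K L" "s \<le> K \<or> s \<le> L"
    by fastforce
  then have "s \<le> m * d Z K \<or> s \<le> m * d (Z\<inverse>) L"
    unfolding inv_def by linarith
  then show False
    using m d_small mult_le_mono2[of _ m m] by (meson leD le_trans)
qed

section \<open>The square-root bounds\<close>

theorem theorem1p4:
  fixes Z :: "(nat \<times> nat) set" and s :: nat
  assumes "zero_set Z" and "Z \<noteq> {}" and "s = square_size Z"
  shows "ereal_of_enat (mu_en Z) \<ge> ereal (sqrt (real s))
    \<and> mu Z \<ge> mu_th Z
    \<and> ereal_of_enat (mu_th Z) \<ge> ereal (sqrt (real s - 1))"
proof -
  have Z: "young Z"
    using assms(1) by (rule zero_set_young)
  have rect: "rect s s \<subseteq> Z" and nrect: "\<not> rect (s + 1) (s + 1) \<subseteq> Z"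
    using square_size_rect[OF Z] assms(3) by auto
  obtain a b where "(a, b) \<in> Z"
    using assms(2) by auto
  then have "(0, 0) \<in> Z"
    using youngD[OF Z] by blast
  then have s: "0 < s"
    using nrect by (cases s) (auto simp: rect_def)
  \<comment> \<open>This is the square root of \<open>s\<close> rounded up, minus 1: minimality
    gives \<open>m * m < s\<close>, with positivity of \<open>s\<close> covering
    \<open>m = 0\<close>.\<close>
  define m where "m = (LEAST m. s \<le> Suc m * Suc m)"
  have "s \<le> Suc s * Suc s" by simp
  then have sm: "s \<le> Suc m * Suc m"
    unfolding m_def by (rule LeastI)
  have "m * m < s"
  proof (cases m)
    case (Suc m')
    then show ?thesis
      using not_less_Least[of m' "\<lambda>m. s \<le> Suc m * Suc m"] unfolding m_def[symmetric] by simp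
  qed (use s in simp)
  then obtain r c where slow: "slow_pair Z m r c"
    using slow_pair_exists[OF Z rect] by blast
  have "real s \<le> real (Suc m) ^ 2"
    using sm by (metis of_nat_le_iff of_nat_mult power2_eq_square)
  then have sqrt: "sqrt (real s) \<le> real (Suc m)"
    by (simp add: real_le_lsqrt)
  have *: "ereal (sqrt (real s)) \<le> ereal_of_enat e" if "enat (Suc m) \<le> e" for e
    using sqrt that by (cases e) auto
  \<comment> \<open>The slow pair gives the bound \<open>sqrt s\<close> for thin sets too; it is
    weakened to the stated form.\<close>
  have "ereal (sqrt (real s - 1)) \<le> ereal (sqrt (real s))"
    by simp
  then have "ereal (sqrt (real s - 1)) \<le> ereal_of_enat (mu_th Z)"
    using *[OF slow_pair_mu_th[OF Z slow]] by (rule order_trans)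
  moreover have "mu_th Z \<le> mu Z"
    unfolding mu_def mu_th_def by (rule SUP_subset_mono) (auto simp: thin_def)
  ultimately show ?thesis
    using *[OF slow_pair_mu_en[OF Z slow]] by blast
qed

end
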